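(* Every simple group $G$ of cardinality $|G| \leq c$, where $c = 2^{\aleph_0}$, is natural.
   Context: A group $(G,* )$ is called natural if there exists a metric $d$ on the set $G$ such that (i) all right translations $x \mapsto x*a$ ($a \in G$) are isometries of $(G,d)$, and (ii) every group structure $(G,\circ)$ on the same set $G$ for which all right translations $x \mapsto x \circ a$ are isometries of $(G,d)$ is isomorphic as a group to $(G,* )$. *)

theory Defs
  imports "HOL-Analysis.Abstract_Metric_Spaces" "HOL-Algebra.SimpleGroups"
begin

text \<open>
  The locale \<^locale>\<open>simple_group\<close> assumes \<open>order G > 1\<close>. Since \<open>order G\<close> is the natural number
  \<open>card (carrier G)\<close>, which is 0 for infinite carriers, that locale covers finite groups only.
  The following notion of a simple group also covers infinite groups.
\<close>

definition is_simple :: "('a, 'b) monoid_scheme \<Rightarrow> bool" where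
  "is_simple G \<longleftrightarrow> group G \<and> carrier G \<noteq> {\<one>\<^bsub>G\<^esub>} \<and>
     (\<forall>N. N \<lhd> G \<longrightarrow> N = carrier G \<or> N = {\<one>\<^bsub>G\<^esub>})"

lemma is_simple_iff_simple_group:
  assumes "finite (carrier G)"
  shows "is_simple G \<longleftrightarrow> simple_group G"
proof
  assume s: "is_simple G"
  then interpret group G by (simp add: is_simple_def)
  have "{\<one>\<^bsub>G\<^esub>} \<subset> carrier G"
    using s by (auto simp: is_simple_def)
  then have "card {\<one>\<^bsub>G\<^esub>} < card (carrier G)"
    using assms by (rule psubset_card_mono[rotated])
  then show "simple_group G"
    using s by unfold_locales (auto simp: is_simple_def order_def)
next
  assume "simple_group G"
  then interpret simple_group G .
  show "is_simple G"
    using simple_not_triv no_real_normal_subgroup is_group by (auto simp: is_simple_def)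
qed

definition isometry_on :: "'a set \<Rightarrow> ('a \<Rightarrow> 'a \<Rightarrow> real) \<Rightarrow> ('a \<Rightarrow> 'a) \<Rightarrow> bool" where
  "isometry_on M d f \<longleftrightarrow> bij_betw f M M \<and> (\<forall>x\<in>M. \<forall>y\<in>M. d (f x) (f y) = d x y)"

definition right_translations_isometric ::
    "('a, 'b) monoid_scheme \<Rightarrow> ('a \<Rightarrow> 'a \<Rightarrow> real) \<Rightarrow> bool" where
  "right_translations_isometric G d \<longleftrightarrow>
     (\<forall>a\<in>carrier G. isometry_on (carrier G) d (\<lambda>x. x \<otimes>\<^bsub>G\<^esub> a))"

definition natural_group :: "('a, 'b) monoid_scheme \<Rightarrow> bool" where
  "natural_group G \<longleftrightarrow> group G \<and>
     (\<exists>d. Metric_space (carrier G) d \<and>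
          right_translations_isometric G d \<and>
          (\<forall>H :: 'a monoid. group H \<and> carrier H = carrier G \<and> right_translations_isometric H d
              \<longrightarrow> H \<cong> G))"

end

theory Submission
  imports Defs "HOL-Algebra.Multiplicative_Group"
begin

text \<open>
  Let \<open>k\<close> be an injection of \<open>G\<close> into \<open>[0,1)\<close>; the cardinality bound is what provides it. For
  \<open>x \<noteq> y\<close> put \<open>d x y = 1 + max (k (x y\<^sup>-\<^sup>1)) (k (y x\<^sup>-\<^sup>1))\<close>. This depends only on the quotient
  \<open>x y\<^sup>-\<^sup>1\<close>, so right translations are isometries, and the triangle inequality holds because all
  nonzero distances lie between 1 and 2. Since \<open>k\<close> is injective, the distance determines the
  quotient up to inversion: every isometry \<open>f\<close> satisfies
  \<open>f x (f y)\<^sup>-\<^sup>1 \<in> {x y\<^sup>-\<^sup>1, y x\<^sup>-\<^sup>1}\<close> (\<open>right_invariant_metric_exists\<close>).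

  Such maps are nearly right translations. If \<open>f\<close> fixes \<open>1\<close>, it sends each element to itself or
  to its inverse, and if some \<open>y\<close> is not fixed, then \<open>y\<^sup>2\<close> is a nontrivial central element
  (\<open>square_central_if_moved\<close>). The center of a nonabelian simple group is trivial, so there \<open>f\<close>
  is the identity. Hence every isometry of a nonabelian simple group is a right translation, and
  a second group structure whose right translations are isometries satisfies
  \<open>x \<circ> a = x (1 \<circ> a)\<close>. The map \<open>a \<mapsto> 1 \<circ> a\<close> is then an isomorphism from the second
  structure to \<open>G\<close> (\<open>iso_if_right_translations_agree\<close>).

  An abelian simple group has prime order, and all groups of the same prime order are isomorphic,
  so in that case any right-invariant metric will do.
\<close>

section \<open>Abelian simple groups\<close>

lemma (in group) cyclic_iso_quotient_of_integers:
  assumes a: "a \<in> carrier G" and gen: "generate G {a} = carrier G"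
  shows "integer_group Mod {i. int (ord a) dvd i} \<cong> G"
proof -
  interpret pow: group_hom integer_group G "\<lambda>i::int. a [^] i"
    using a by (simp add: group_hom_def group_hom_axioms_def hom_integer_group_pow)
  have "(\<lambda>i::int. a [^] i) ` carrier integer_group = carrier G"
    using gen generate_pow[OF a] by (auto simp: full_SetCompr_eq)
  then have "integer_group Mod kernel integer_group G (\<lambda>i::int. a [^] i) \<cong> G"
    by (rule pow.FactGroup_iso)
  moreover have "kernel integer_group G (\<lambda>i::int. a [^] i) = {i. int (ord a) dvd i}"
    using a by (simp add: kernel_def int_pow_eq_id)
  ultimately show ?thesis
    by simp
qed

lemma cyclic_groups_same_order_iso:
  assumes G: "group G" "a \<in> carrier G" "generate G {a} = carrier G"
    and H: "group H" "b \<in> carrier H" "generate H {b} = carrier H"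
    and ord: "group.ord G a = group.ord H b"
  shows "G \<cong> H"
proof -
  let ?Z = "integer_group Mod {i. int (group.ord G a) dvd i}"
  \<comment> \<open>If \<open>a\<close> has infinite order, encoded as order 0, the quotient is by the zero subgroup.\<close>
  have "?Z \<cong> G" "?Z \<cong> H"
    using group.cyclic_iso_quotient_of_integers[OF G]
      group.cyclic_iso_quotient_of_integers[OF H] ord by simp_all
  moreover have "group ?Z"
  proof -
    interpret pow: group_hom integer_group G "\<lambda>i::int. a [^]\<^bsub>G\<^esub> i"
      using G by (simp add: group_hom_def group_hom_axioms_def group.hom_integer_group_pow)
    have "kernel integer_group G (\<lambda>i::int. a [^]\<^bsub>G\<^esub> i) = {i. int (group.ord G a) dvd i}"
      using G by (simp add: kernel_def group.int_pow_eq_id)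
    then show ?thesis
      using normal.factorgroup_is_group[OF pow.normal_kernel] by simp
  qed
  ultimately show ?thesis
    using group.iso_sym iso_trans by blast
qed

lemma (in group) prime_order_generator:
  assumes "prime (order G)" "a \<in> carrier G" "a \<noteq> \<one>"
  shows "generate G {a} = carrier G" and "ord a = order G"
proof -
  have fin: "finite (carrier G)"
    using prime_gt_0_nat[OF assms(1)] by (simp add: order_gt_0_iff_finite)
  have "ord a \<noteq> 1"
    using assms ord_eq_1[of a] by simp
  then show ord: "ord a = order G"
    using assms(1) ord_dvd_group_order[OF assms(2)] by (auto simp: prime_nat_iff)
  have "generate G {a} \<subseteq> carrier G"
    using assms generate_incl by auto
  then show "generate G {a} = carrier G"
    using fin ord generate_pow_card[OF assms(2)] by (simp add: card_subset_eq order_def)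
qed

corollary prime_order_iso:
  assumes "group G" "group H" "order G = order H" "prime (order G)"
  shows "G \<cong> H"
proof -
  interpret G: group G by fact
  interpret H: group H by fact
  have "carrier G \<noteq> {\<one>\<^bsub>G\<^esub>}"
    using assms(4) by (auto simp: order_def)
  moreover have "carrier H \<noteq> {\<one>\<^bsub>H\<^esub>}"
    using assms(4) unfolding assms(3) by (auto simp: order_def)
  ultimately obtain a b where a: "a \<in> carrier G" "a \<noteq> \<one>\<^bsub>G\<^esub>"
    and b: "b \<in> carrier H" "b \<noteq> \<one>\<^bsub>H\<^esub>"
    using G.one_closed H.one_closed by blast
  have "prime (order H)"
    using assms(3,4) by simp
  note a_gen = G.prime_order_generator[OF assms(4) a]
    and b_gen = H.prime_order_generator[OF this b]
  have "G.ord a = H.ord b"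
    using a_gen(2) b_gen(2) assms(3) by simp
  with a_gen(1) b_gen(1) show ?thesis
    by (rule cyclic_groups_same_order_iso[OF assms(1) a(1) _ assms(2) b(1)])
qed

text \<open>
  A nontrivial element \<open>a\<close> of a simple abelian group generates it. For a prime \<open>q\<close> dividing the order
  of \<open>a\<close>, the element \<open>a\<^sup>q\<close> does not generate the group: \<open>a = a\<^sup>q\<^sup>m\<close> would make \<open>q\<close> divide
  \<open>q m - 1\<close>. So \<open>a\<^sup>q\<close> is trivial and the order of \<open>a\<close> is \<open>q\<close>.
  The case of infinite order needs no separate treatment, since it is encoded as 0 and every prime
  divides 0.
\<close>

lemma (in comm_group) simple_imp_prime_order:
  assumes "is_simple G"
  shows "prime (order G)"
proof -
  have subgroups: "N = carrier G \<or> N = {\<one>}" if "subgroup N G" for N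
    using assms subgroup_imp_normal[OF that] by (auto simp: is_simple_def)
  obtain a where a: "a \<in> carrier G" "a \<noteq> \<one>"
    using assms by (auto simp: is_simple_def)
  have "a \<in> generate G {a}"
    by (simp add: generate.incl)
  then have gen: "generate G {a} = carrier G"
    using a subgroups[OF generate_is_subgroup[of "{a}"]] by auto
  have "ord a \<noteq> 1"
    using a ord_eq_1[of a] by simp
  then obtain q where q: "prime q" "q dvd ord a"
    using prime_factor_nat by blast
  have "generate G {a [^] q} \<noteq> carrier G"
  proof
    assume "generate G {a [^] q} = carrier G"
    then obtain m :: int where "a = (a [^] q) [^] m"
      using a generate_pow[of "a [^] q"] by auto
    then have "a [^] (1::int) = a [^] (int q * m)"
      using a by (simp add: int_pow_pow flip: int_pow_int)
    then have "int (ord a) dvd int q * m - 1"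
      using a int_pow_eq[of a 1 "int q * m"] by blast
    then have "int q dvd int q * m - 1"
      using q(2) by (meson dvd_trans of_nat_dvd_iff)
    then have "int q dvd int q * m - (int q * m - 1)"
      by (rule dvd_diff[OF dvd_triv_left])
    then have "q = 1"
      by simp
    then show False
      using q(1) by simp
  qed
  then have "generate G {a [^] q} = {\<one>}"
    using a subgroups[OF generate_is_subgroup[of "{a [^] q}"]] by auto
  then have "a [^] q = \<one>"
    using generate.incl[of "a [^] q" "{a [^] q}" G] by auto
  then have "ord a = q"
    using a q(2) pow_eq_id[of a q] dvd_antisym[of q "ord a"] by simp
  moreover have "ord a = order G"
    using generate_pow_card[OF a(1)] gen by (simp add: order_def)
  ultimately show ?thesis
    using q(1) by metis
qed

section \<open>Rigidity of maps that preserve quotients up to inversion\<close>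

definition (in group) preserves_quotients_up_to_inverse :: "('a \<Rightarrow> 'a) \<Rightarrow> bool" where
  "preserves_quotients_up_to_inverse f \<longleftrightarrow>
     f \<in> carrier G \<rightarrow> carrier G \<and>
     (\<forall>x\<in>carrier G. \<forall>y\<in>carrier G. f x \<otimes> inv f y \<in> {x \<otimes> inv y, y \<otimes> inv x})"

lemma (in group) preserves_quotientsD:
  assumes "preserves_quotients_up_to_inverse f" "x \<in> carrier G"
  shows "f x \<in> carrier G"
    and "y \<in> carrier G \<Longrightarrow> f x \<otimes> inv f y \<in> {x \<otimes> inv y, y \<otimes> inv x}"
  using assms unfolding preserves_quotients_up_to_inverse_def by blast+

text \<open>
  Since \<open>f\<close> sends \<open>y\<close> to \<open>y\<^sup>-\<^sup>1 \<noteq> y\<close>, the quotient condition for \<open>y\<close> and \<open>z\<close> leaves three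
  possibilities. If \<open>f\<close> fixes \<open>z\<close>, then \<open>y\<close> conjugates \<open>z\<close> to its inverse, so \<open>y\<^sup>2\<close> conjugates
  it back to itself. If \<open>f\<close> inverts \<open>z\<close>, then \<open>y\<^sup>2 = z\<^sup>2\<close> or \<open>y\<close> commutes with \<open>z\<close>. In each of them
  \<open>y\<^sup>2\<close> commutes with \<open>z\<close>.
\<close>

lemma (in group) square_central_if_moved:
  assumes f: "preserves_quotients_up_to_inverse f" and "f \<one> = \<one>"
    and y: "y \<in> carrier G" "f y \<noteq> y"
  shows "y \<otimes> y \<noteq> \<one>" and "\<forall>z\<in>carrier G. y \<otimes> y \<otimes> z = z \<otimes> (y \<otimes> y)"
proof -
  have fixed_or_inverted: "f x = x \<or> f x = inv x" if "x \<in> carrier G" for x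
  proof -
    have "f x \<in> carrier G" and "f x \<otimes> inv f \<one> \<in> {x \<otimes> inv \<one>, \<one> \<otimes> inv x}"
      using preserves_quotientsD[OF f that] by blast+
    then show ?thesis
      using that \<open>f \<one> = \<one>\<close> by simp
  qed
  from this[OF y(1)] have fy: "f y = inv y"
    using y(2) by simp
  with y(2) have "inv y \<noteq> y"
    by simp
  then show "y \<otimes> y \<noteq> \<one>"
    using y inv_equality[of y y] by auto
  show "\<forall>z\<in>carrier G. y \<otimes> y \<otimes> z = z \<otimes> (y \<otimes> y)"
  proof
    fix z assume z: "z \<in> carrier G"
    have quot: "inv y \<otimes> inv f z \<in> {y \<otimes> inv z, z \<otimes> inv y}"
      using preserves_quotientsD(2)[OF f y(1) z] unfolding fy .
    from fixed_or_inverted[OF z] show "y \<otimes> y \<otimes> z = z \<otimes> (y \<otimes> y)"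
    proof
      assume "f z = z"
      then have conj: "inv y \<otimes> inv z = z \<otimes> inv y"
        using quot \<open>inv y \<noteq> y\<close> y z by auto
      have inverts: "z \<otimes> y = y \<otimes> inv z"
        using arg_cong[of _ _ "m_inv G", OF conj] y z by (simp add: inv_mult_group)
      have "inv z \<otimes> y = inv z \<otimes> (y \<otimes> inv z) \<otimes> z"
        using y z by (simp add: m_assoc)
      also have "\<dots> = y \<otimes> z"
        using y z by (simp flip: inverts m_assoc)
      finally have "y \<otimes> z = inv z \<otimes> y" ..
      then have "y \<otimes> y \<otimes> z = y \<otimes> inv z \<otimes> y"
        using y z by (simp add: m_assoc)
      also have "\<dots> = z \<otimes> (y \<otimes> y)"
        using y z by (simp add: m_assoc flip: inverts)
      finally show ?thesis .
    next
      assume "f z = inv z"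
      then have "inv y \<otimes> z = y \<otimes> inv z \<or> inv y \<otimes> z = z \<otimes> inv y"
        using quot z by auto
      then show ?thesis
      proof
        assume "inv y \<otimes> z = y \<otimes> inv z"
        then have "z = y \<otimes> (y \<otimes> inv z)"
          using y(1) z by (simp add: inv_solve_left')
        then have "z = y \<otimes> y \<otimes> inv z"
          using y(1) z by (simp add: m_assoc)
        then have "y \<otimes> y = z \<otimes> z"
          using y(1) z inv_solve_right[of z "y \<otimes> y" z] by simp
        then show ?thesis
          using z by (simp add: m_assoc)
      next
        assume "inv y \<otimes> z = z \<otimes> inv y"
        then have "z = y \<otimes> (z \<otimes> inv y)"
          using y(1) z by (simp add: inv_solve_left')
        then have "z = y \<otimes> z \<otimes> inv y"
          using y(1) z by (simp add: m_assoc)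
        then have commute: "y \<otimes> z = z \<otimes> y"
          using y(1) z inv_solve_right[of z "y \<otimes> z" y] by simp
        have "y \<otimes> y \<otimes> z = y \<otimes> (z \<otimes> y)"
          using y(1) z by (simp add: m_assoc commute)
        also have "\<dots> = y \<otimes> z \<otimes> y"
          using y(1) z by (simp add: m_assoc)
        also have "\<dots> = z \<otimes> y \<otimes> y"
          by (rule arg_cong[OF commute])
        also have "\<dots> = z \<otimes> (y \<otimes> y)"
          using y(1) z by (simp add: m_assoc)
        finally show ?thesis .
      qed
    qed
  qed
qed

lemma (in group) center_normal:
  "{c \<in> carrier G. \<forall>z\<in>carrier G. c \<otimes> z = z \<otimes> c} \<lhd> G" (is "?Z \<lhd> G")
proof (rule normal_invI)
  show "subgroup ?Z G"
  proof (rule subgroupI)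
    fix x assume "x \<in> ?Z"
    then have x: "x \<in> carrier G" "\<And>z. z \<in> carrier G \<Longrightarrow> x \<otimes> z = z \<otimes> x"
      by auto
    have "inv x \<otimes> z = z \<otimes> inv x" if z: "z \<in> carrier G" for z
    proof -
      have "inv x \<otimes> z = inv x \<otimes> (z \<otimes> x) \<otimes> inv x"
        using x(1) z by (simp add: m_assoc)
      also have "\<dots> = z \<otimes> inv x"
        using x(1) z by (simp flip: x(2) m_assoc)
      finally show ?thesis .
    qed
    with x(1) show "inv x \<in> ?Z"
      by simp
  next
    fix x y assume "x \<in> ?Z" "y \<in> ?Z"
    then have xy: "x \<in> carrier G" "y \<in> carrier G"
      "\<And>z. z \<in> carrier G \<Longrightarrow> x \<otimes> z = z \<otimes> x" "\<And>z. z \<in> carrier G \<Longrightarrow> y \<otimes> z = z \<otimes> y"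
      by auto
    have "x \<otimes> y \<otimes> z = z \<otimes> (x \<otimes> y)" if z: "z \<in> carrier G" for z
    proof -
      have "x \<otimes> y \<otimes> z = x \<otimes> z \<otimes> y"
        using xy(1,2) z by (simp add: m_assoc xy(4)[OF z])
      also have "\<dots> = z \<otimes> (x \<otimes> y)"
        using xy(1,2) z by (simp add: m_assoc xy(3)[OF z])
      finally show ?thesis .
    qed
    with xy(1,2) show "x \<otimes> y \<in> ?Z"
      by simp
  qed auto
next
  fix x h assume x: "x \<in> carrier G" and h: "h \<in> ?Z"
  then have "h \<in> carrier G" "x \<otimes> h = h \<otimes> x"
    by auto
  with x have "x \<otimes> h \<otimes> inv x = h"
    by (simp add: m_assoc)
  with h show "x \<otimes> h \<otimes> inv x \<in> ?Z"
    by simp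
qed

lemma (in group) simple_nonabelian_quotient_rigid:
  assumes simple: "is_simple G" and nonabelian: "\<not> comm_group G"
    and f: "preserves_quotients_up_to_inverse f" and x: "x \<in> carrier G"
  shows "f x = x \<otimes> f \<one>"
proof -
  have closed: "f u \<in> carrier G" if "u \<in> carrier G" for u
    using preserves_quotientsD(1)[OF f that] .
  \<comment> \<open>Translating by the inverse of \<open>f \<one>\<close> reduces the claim to a map that fixes the unit.\<close>
  define g where "g u = f u \<otimes> inv f \<one>" for u
  have "g u \<otimes> inv g v = f u \<otimes> inv f v" if "u \<in> carrier G" "v \<in> carrier G" for u v
    using that closed by (simp add: g_def inv_mult_group m_assoc flip: m_assoc[of "inv f \<one>" "f \<one>"])
  then have g: "preserves_quotients_up_to_inverse g"
    using preserves_quotientsD(2)[OF f] closed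
    by (auto simp: preserves_quotients_up_to_inverse_def g_def)
  have "g \<one> = \<one>"
    by (simp add: g_def closed)
  have "g x = x"
  proof (rule ccontr)
    assume "g x \<noteq> x"
    let ?Z = "{c \<in> carrier G. \<forall>z\<in>carrier G. c \<otimes> z = z \<otimes> c}"
    have "x \<otimes> x \<in> ?Z" "x \<otimes> x \<noteq> \<one>"
      using square_central_if_moved[OF g \<open>g \<one> = \<one>\<close> x \<open>g x \<noteq> x\<close>] x by auto
    then have "?Z = carrier G"
      using simple center_normal unfolding is_simple_def by blast
    then have "comm_group G"
      by (intro group_comm_groupI) auto
    then show False
      using nonabelian by simp
  qed
  then show ?thesis
    using x closed[OF x] closed[OF one_closed] by (simp add: g_def inv_solve_right')
qed

section \<open>A right-invariant metric that determines quotients up to inversion\<close>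

text \<open>
  Symmetrizing an injective labelling by a maximum keeps it injective on pairs \<open>{u, u\<^sup>-\<^sup>1}\<close>, because
  the maximum is attained at one of the two elements and so reveals the pair. Adding 1 to
  labels from \<open>[0,1)\<close> gives distances from \<open>[1,2)\<close>, which satisfy the triangle inequality.
\<close>

lemma (in group) right_invariant_metric_exists:
  assumes "carrier G \<lesssim> (UNIV :: nat set set)"
  obtains d where "Metric_space (carrier G) d" "right_translations_isometric G d"
    "\<And>f. isometry_on (carrier G) d f \<Longrightarrow> preserves_quotients_up_to_inverse f"
proof -
  have "carrier G \<lesssim> {0..<1::real}"
    using assms nat_sets_lepoll_reals01 lepoll_trans by blast
  then obtain k :: "'a \<Rightarrow> real" where inj: "inj_on k (carrier G)"
    and range: "k ` carrier G \<subseteq> {0..<1}"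
    unfolding lepoll_def by blast
  define p where "p u = max (k u) (k (inv u))" for u
  have p: "0 \<le> p u" "p u < 1" if "u \<in> carrier G" for u
    using range that unfolding p_def by (force simp: image_subset_iff)+
  have p_inv: "p (inv u) = p u" if "u \<in> carrier G" for u
    using that by (simp add: p_def max.commute)
  have p_eqD: "u = v \<or> u = inv v" if "p u = p v" "u \<in> carrier G" "v \<in> carrier G" for u v
    using that inj unfolding p_def inj_on_def max_def
    by (metis inv_closed inv_inv)
  \<comment> \<open>The metric axioms demand symmetry and nonnegativity for all arguments, also outside the
    carrier; the value 0 there provides both.\<close>
  define d where "d x y = (if x \<in> carrier G \<and> y \<in> carrier G \<and> x \<noteq> y then 1 + p (x \<otimes> inv y) else 0)" for x y
  have inv_quot: "inv (x \<otimes> inv y) = y \<otimes> inv x" if "x \<in> carrier G" "y \<in> carrier G" for x y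
    using that by (simp add: inv_mult_group)
  have "Metric_space (carrier G) d"
  proof
    show "0 \<le> d x y" for x y
      using p by (simp add: d_def)
    show "d x y = d y x" for x y
      using p_inv[of "x \<otimes> inv y"] by (auto simp: d_def inv_quot)
    fix x y assume "x \<in> carrier G" "y \<in> carrier G"
    then show "d x y = 0 \<longleftrightarrow> x = y"
      using p(1)[of "x \<otimes> inv y"] by (auto simp: d_def)
    fix z assume "z \<in> carrier G"
    then show "d x z \<le> d x y + d y z"
      using \<open>x \<in> carrier G\<close> \<open>y \<in> carrier G\<close> p[of "x \<otimes> inv z"] p[of "x \<otimes> inv y"] p[of "y \<otimes> inv z"]
      by (auto simp: d_def)
  qed
  moreover have "right_translations_isometric G d"
    unfolding right_translations_isometric_def isometry_on_def
  proof (intro ballI conjI)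
    fix a assume a: "a \<in> carrier G"
    show "bij_betw (\<lambda>x. x \<otimes> a) (carrier G) (carrier G)"
      by (rule bij_betw_byWitness[where f' = "\<lambda>x. x \<otimes> inv a"]) (use a in \<open>auto simp: m_assoc\<close>)
    fix x y assume xy: "x \<in> carrier G" "y \<in> carrier G"
    have "x \<otimes> a \<otimes> inv (y \<otimes> a) = x \<otimes> inv y"
      using a xy by (simp add: inv_mult_group m_assoc flip: m_assoc[of a "inv a"])
    then show "d (x \<otimes> a) (y \<otimes> a) = d x y"
      using a xy by (simp add: d_def)
  qed
  moreover have "preserves_quotients_up_to_inverse f" if f: "isometry_on (carrier G) d f" for f
  proof -
    have f_bij: "bij_betw f (carrier G) (carrier G)"
      and f_dist: "\<And>x y. x \<in> carrier G \<Longrightarrow> y \<in> carrier G \<Longrightarrow> d (f x) (f y) = d x y"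
      using f by (auto simp: isometry_on_def)
    have closed: "f x \<in> carrier G" if "x \<in> carrier G" for x
      using f_bij that by (auto dest: bij_betwE)
    have "f x \<otimes> inv f y \<in> {x \<otimes> inv y, y \<otimes> inv x}" if xy: "x \<in> carrier G" "y \<in> carrier G" for x y
    proof (cases "x = y")
      case True
      then show ?thesis
        using xy closed by simp
    next
      case False
      then have "f x \<noteq> f y"
        using f_bij xy by (auto simp: bij_betw_def inj_on_def)
      then have "p (f x \<otimes> inv f y) = p (x \<otimes> inv y)"
        using f_dist[OF xy] False xy closed by (simp add: d_def)
      then show ?thesis
        using p_eqD[of "f x \<otimes> inv f y" "x \<otimes> inv y"] xy closed by (simp add: inv_quot)
    qed
    then show ?thesis
      using closed by (auto simp: preserves_quotients_up_to_inverse_def)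
  qed
  ultimately show thesis
    by (rule that)
qed

section \<open>Naturality\<close>

text \<open>
  If \<open>x \<circ> a = x * \<phi>(a)\<close> with \<open>\<phi>(a) = 1 \<circ> a\<close>, then associativity of \<open>\<circ>\<close> gives
  \<open>\<phi>(a \<circ> b) = \<phi>(a) \<circ> b = \<phi>(a) * \<phi>(b)\<close>. The map \<open>\<phi>\<close> is bijective because it is a left
  translation for \<open>\<circ>\<close>. Here \<open>1\<close> is the unit of \<open>*\<close>, which may differ from the unit of \<open>\<circ>\<close>.
\<close>

lemma iso_if_right_translations_agree:
  fixes G :: "('a, 'b) monoid_scheme" and H :: "('a, 'c) monoid_scheme"
  assumes "group G" "group H" and carrier: "carrier H = carrier G"
    and translation: "\<And>a x. a \<in> carrier G \<Longrightarrow> x \<in> carrier G \<Longrightarrow>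
      x \<otimes>\<^bsub>H\<^esub> a = x \<otimes>\<^bsub>G\<^esub> (\<one>\<^bsub>G\<^esub> \<otimes>\<^bsub>H\<^esub> a)"
  shows "H \<cong> G"
proof -
  interpret G: group G by fact
  interpret H: group H by fact
  define \<phi> where "\<phi> a = \<one>\<^bsub>G\<^esub> \<otimes>\<^bsub>H\<^esub> a" for a
  have one: "\<one>\<^bsub>G\<^esub> \<in> carrier H"
    by (simp add: carrier)
  have "\<phi> \<in> hom H G"
  proof (rule homI)
    show closed: "\<phi> a \<in> carrier G" if "a \<in> carrier H" for a
      using that one H.m_closed carrier unfolding \<phi>_def by blast
    show "\<phi> (a \<otimes>\<^bsub>H\<^esub> b) = \<phi> a \<otimes>\<^bsub>G\<^esub> \<phi> b" if "a \<in> carrier H" "b \<in> carrier H" for a b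
    proof -
      have "\<phi> (a \<otimes>\<^bsub>H\<^esub> b) = \<phi> a \<otimes>\<^bsub>H\<^esub> b"
        using that one by (simp add: \<phi>_def H.m_assoc)
      also have "\<dots> = \<phi> a \<otimes>\<^bsub>G\<^esub> \<phi> b"
        using that closed translation[of b "\<phi> a"] by (simp add: \<phi>_def carrier)
      finally show ?thesis .
    qed
  qed
  moreover have "bij_betw \<phi> (carrier H) (carrier G)"
    unfolding carrier[symmetric] \<phi>_def
    by (rule bij_betw_byWitness[where f' = "\<lambda>x. inv\<^bsub>H\<^esub> \<one>\<^bsub>G\<^esub> \<otimes>\<^bsub>H\<^esub> x"])
      (use one in \<open>auto simp flip: H.m_assoc\<close>)
  ultimately show ?thesis
    by (auto simp: is_iso_def iso_def)
qed

theorem corollary4: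
  fixes G :: "('a, 'b) monoid_scheme"
  assumes "is_simple G"
    and "carrier G \<lesssim> (UNIV :: nat set set)"
  shows "natural_group G"
proof -
  interpret group G
    using assms(1) by (simp add: is_simple_def)
  obtain d where d: "Metric_space (carrier G) d" "right_translations_isometric G d"
    and quotients: "\<And>f. isometry_on (carrier G) d f \<Longrightarrow> preserves_quotients_up_to_inverse f"
    using right_invariant_metric_exists[OF assms(2)] by blast
  have "H \<cong> G"
    if H: "group H" "carrier H = carrier G" "right_translations_isometric H d" for H :: "'a monoid"
  proof (cases "comm_group G")
    case True
    then have "prime (order G)"
      using assms(1) by (rule comm_group.simple_imp_prime_order)
    then show ?thesis
      using H by (intro prime_order_iso) (auto simp: order_def)
  next
    case False
    show ?thesis
    proof (rule iso_if_right_translations_agree)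
      fix a x assume a: "a \<in> carrier G" and x: "x \<in> carrier G"
      have "isometry_on (carrier G) d (\<lambda>u. u \<otimes>\<^bsub>H\<^esub> a)"
        using H a by (simp add: right_translations_isometric_def)
      from simple_nonabelian_quotient_rigid[OF assms(1) False quotients[OF this] x]
      show "x \<otimes>\<^bsub>H\<^esub> a = x \<otimes>\<^bsub>G\<^esub> (\<one>\<^bsub>G\<^esub> \<otimes>\<^bsub>H\<^esub> a)" .
    qed (use H in auto)
  qed
  then show ?thesis
    unfolding natural_group_def using d by (intro conjI exI[of _ d]) auto
qed

end
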